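(* Let $H=\bigoplus_{n\in\mathbb{N}_0}H^n$ be a Gerstenhaber algebra with bracket $[\,,\,]$. Let $n,m\in\mathbb{N}_0$ and let $x\in H^{n+1}$, $y\in H^n$, $a_x\in H^0$, $a_y\in H^1$ and $z\in H^m$ satisfy $a_xx=a_yy$. Suppose that there is a vector subspace $M\subseteq H^{n+m-1}$ such that $[y,z]\in M$ and such that the map $\mu_{a_y}:M\to H^{n+m}$, $v\mapsto a_yv$, is injective. Then $[y,z]$ is the unique element $v\in M$ such that $$a_yv=(-1)^{m-1}\big(a_x[x,z]+[a_x,z]x-[a_y,z]y\big).$$
   Context: A Gerstenhaber algebra (over a field $\Bbbk$) is a graded-commutative algebra $H=\bigoplus_{n\in\mathbb{N}_0}H^n$ endowed with a linear bracket $[\,,\,]:H\otimes H\to H$ satisfying $[H^m,H^n]\subseteq H^{m+n-1}$ for $m,n\in\mathbb{N}_0$ (with $H^{-1}=0$) and, for all $x\in H^m$, $y\in H^n$, $z\in H^p$, $$[x,y]=-(-1)^{(m-1)(n-1)}[y,x],\qquad [x,[y,z]]=[[x,y],z]+(-1)^{(m-1)(n-1)}[y,[x,z]],$$ $$[xy,z]=[x,z]y+(-1)^{m(p-1)}x[y,z].$$ *)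

theory Defs
  imports Complex_Main
begin

text \<open>
  The sort \<open>{ring, monoid_mult}\<close> is that of associative unital, not necessarily commutative
  rings; unlike \<open>ring_1\<close> it does not exclude the zero ring.
\<close>

locale unital_algebra = vector_space scale
  for scale :: "'k::field \<Rightarrow> 'a::{ring, monoid_mult} \<Rightarrow> 'a" +
  assumes scale_mult_left: "scale c (x * y) = scale c x * y"
    and scale_mult_right: "scale c (x * y) = x * scale c y"

text \<open>
  Internal direct sum: every element is in a unique way a finite sum of homogeneous components.
\<close>

locale graded_algebra = unital_algebra scale
  for scale :: "'k::field \<Rightarrow> 'a::{ring, monoid_mult} \<Rightarrow> 'a" +
  fixes H :: "nat \<Rightarrow> 'a set"
  assumes subspace_H: "subspace (H n)"
    and direct_sum: "\<exists>!c :: nat \<Rightarrow> 'a. (\<forall>n. c n \<in> H n) \<and> finite {n. c n \<noteq> 0} \<and>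
                        x = (\<Sum>n | c n \<noteq> 0. c n)"
    and one_in_H: "1 \<in> H 0"
    and mult_in_H: "x \<in> H m \<Longrightarrow> y \<in> H n \<Longrightarrow> x * y \<in> H (m + n)"

locale graded_commutative_algebra = graded_algebra scale H
  for scale :: "'k::field \<Rightarrow> 'a::{ring, monoid_mult} \<Rightarrow> 'a" and H +
  assumes graded_commute:
    "x \<in> H m \<Longrightarrow> y \<in> H n \<Longrightarrow> x * y = scale ((-1) ^ (m * n)) (y * x)"

text \<open>
  Extension of the grading to integer degrees by zero, so that the convention
  \<open>H\<^sup>-\<^sup>1 = 0\<close> applies where truncated subtraction on \<open>nat\<close> would give \<open>H\<^sup>0\<close>.
\<close>

definition degree_part :: "(nat \<Rightarrow> 'a::zero set) \<Rightarrow> int \<Rightarrow> 'a set" where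
  "degree_part H i = (if i < 0 then {0} else H (nat i))"

text \<open>
  A linear map on \<open>H \<otimes> H\<close> is given as a bilinear map. Exponents of signs such as
  \<open>(m - 1) (n - 1)\<close> can be negative, hence the integer power \<open>powi\<close>.
\<close>

locale gerstenhaber_algebra = graded_commutative_algebra scale H
  for scale :: "'k::field \<Rightarrow> 'a::{ring, monoid_mult} \<Rightarrow> 'a" and H +
  fixes bracket :: "'a \<Rightarrow> 'a \<Rightarrow> 'a"
  assumes bracket_linear_left: "Vector_Spaces.linear scale scale (\<lambda>x. bracket x y)"
    and bracket_linear_right: "Vector_Spaces.linear scale scale (\<lambda>y. bracket x y)"
    and bracket_degree:
      "x \<in> H m \<Longrightarrow> y \<in> H n \<Longrightarrow> bracket x y \<in> degree_part H (int m + int n - 1)"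
    and bracket_antisym:
      "x \<in> H m \<Longrightarrow> y \<in> H n \<Longrightarrow>
        bracket x y = - scale ((-1) powi ((int m - 1) * (int n - 1))) (bracket y x)"
    and bracket_jacobi:
      "x \<in> H m \<Longrightarrow> y \<in> H n \<Longrightarrow> z \<in> H p \<Longrightarrow>
        bracket x (bracket y z) = bracket (bracket x y) z
          + scale ((-1) powi ((int m - 1) * (int n - 1))) (bracket y (bracket x z))"
    and bracket_poisson:
      "x \<in> H m \<Longrightarrow> y \<in> H n \<Longrightarrow> z \<in> H p \<Longrightarrow>
        bracket (x * y) z = bracket x z * y
          + scale ((-1) powi (int m * (int p - 1))) (x * bracket y z)"

end

theory Submission imports Defs
begin

text \<open>Bracketing with \<open>z\<close> is a graded derivation, so applying it to
  \<open>a_x * x = a_y * y\<close> and expanding both sides by \<open>bracket_poisson\<close> gives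
  one linear relation in which \<open>bracket y z\<close> occurs only inside
  \<open>a_y * bracket y z\<close>, with a sign. Solving for that term gives the formula;
  injectivity of multiplication by \<open>a_y\<close> on \<open>M\<close> then leaves no other
  solution there.\<close>

theorem lemma4p12:
  fixes scale :: "'k::field \<Rightarrow> 'a::{ring, monoid_mult} \<Rightarrow> 'a"
    and H :: "nat \<Rightarrow> 'a set"
    and bracket :: "'a \<Rightarrow> 'a \<Rightarrow> 'a"
    and n m :: nat
    and x y a_x a_y z :: 'a
    and M :: "'a set"
  assumes "gerstenhaber_algebra scale H bracket"
    and "x \<in> H (n + 1)" and "y \<in> H n" and "a_x \<in> H 0" and "a_y \<in> H 1" and "z \<in> H m"
    and "a_x * x = a_y * y"
    and "module.subspace scale M" and "M \<subseteq> degree_part H (int n + int m - 1)"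
    and "bracket y z \<in> M"
    and "inj_on (\<lambda>v. a_y * v) M"
  shows "bracket y z \<in> M \<and>
    a_y * bracket y z = scale ((-1) powi (int m - 1))
      (a_x * bracket x z + bracket a_x z * x - bracket a_y z * y) \<and>
    (\<forall>v\<in>M. a_y * v = scale ((-1) powi (int m - 1))
      (a_x * bracket x z + bracket a_x z * x - bracket a_y z * y) \<longrightarrow> v = bracket y z)"
proof -
  interpret gerstenhaber_algebra scale H bracket by fact
  define s :: 'k where "s = (-1) powi (int m - 1)"
  define r where "r = a_x * bracket x z + bracket a_x z * x - bracket a_y z * y"
  \<comment> \<open>The exponent is -1 when \<open>m = 0\<close>; merging the bases into a power of
    1 avoids any case distinction on sign or parity.\<close>
  have "s * s = ((-1) * (-1)) powi (int m - 1)"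
    unfolding s_def by (rule power_int_mult_distrib [symmetric])
  then have ss: "s * s = 1" by simp
  \<comment> \<open>Degree 0 of \<open>a_x\<close> makes the Poisson exponent 0, so no sign appears;
    degree 1 of \<open>a_y\<close> below makes the sign exactly \<open>s\<close>.\<close>
  have "bracket (a_x * x) z = bracket a_x z * x + a_x * bracket x z"
    using bracket_poisson [OF \<open>a_x \<in> H 0\<close> \<open>x \<in> H (n + 1)\<close> \<open>z \<in> H m\<close>] by simp
  moreover have "bracket (a_y * y) z = bracket a_y z * y + scale s (a_y * bracket y z)"
    using bracket_poisson [OF \<open>a_y \<in> H 1\<close> \<open>y \<in> H n\<close> \<open>z \<in> H m\<close>] by (simp add: s_def)
  ultimately have "scale s (a_y * bracket y z) = r"
    using \<open>a_x * x = a_y * y\<close> by (simp add: r_def algebra_simps)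
  \<comment> \<open>The sign is its own inverse, so scaling by \<open>s\<close> once more isolates
    \<open>a_y * bracket y z\<close>.\<close>
  then have "scale s r = scale (s * s) (a_y * bracket y z)" by auto
  then have eq: "a_y * bracket y z = scale s r" by (simp add: ss)
  have "v = bracket y z" if "v \<in> M" "a_y * v = scale s r" for v
    using inj_onD [OF \<open>inj_on (\<lambda>v. a_y * v) M\<close>, of v "bracket y z"] that eq \<open>bracket y z \<in> M\<close>
    by simp
  with eq \<open>bracket y z \<in> M\<close> show ?thesis unfolding s_def r_def by blast
qed

end
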